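(* Let $a,b,c,d,e$ be circles in the plane. If $bcd\to e$ is a tight implication and the implications $ab\to e$, $ac\to e$ and $ad\to e$ hold, then $a\to e$ holds.
   Context: A circle means a closed disc in $\mathbb{R}^2$ (its boundary included), possibly of radius $0$, i.e. a single point; a circle is identified with its set of points. For a finite set $Y$ of circles, $\mathrm{CH}(Y)$ denotes the (Euclidean) convex hull of the union of the point sets of the circles in $Y$. For a set $Y$ of circles (written as a word, e.g. $bcd$ for $\{b,c,d\}$) and a circle $u$, the implication $Y\to u$ means $u\subseteq \mathrm{CH}(Y)$. The implication $Y\to u$ is tight if it holds and $u\not\subseteq\mathrm{CH}(Y\setminus\{z\})$ for every $z\in Y$. *)

theory Defs
  imports "HOL-Analysis.Analysis"
begin

definition is_circle :: "(real^2) set \<Rightarrow> bool" where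
  "is_circle u \<longleftrightarrow> (\<exists>x r. 0 \<le> r \<and> u = cball x r)"

definition CH :: "(real^2) set set \<Rightarrow> (real^2) set" where
  "CH Y = convex hull (\<Union>Y)"

definition implication :: "(real^2) set set \<Rightarrow> (real^2) set \<Rightarrow> bool" where
  "implication Y u \<longleftrightarrow> u \<subseteq> CH Y"

definition tight_implication :: "(real^2) set set \<Rightarrow> (real^2) set \<Rightarrow> bool" where
  "tight_implication Y u \<longleftrightarrow> implication Y u \<and> (\<forall>z\<in>Y. \<not> u \<subseteq> CH (Y - {z}))"

text \<open>
  The word \<open>bcd\<close> denotes a set of three circles. Since \<open>{b, c, d}\<close> may collapse
  when letters coincide, pairwise distinctness of \<open>b\<close>, \<open>c\<close>, \<open>d\<close> has to be
  assumed separately wherever a word of length three is meant.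
\<close>

end

theory Submission
  imports Defs
begin

text \<open>
  Write \<open>h Y\<close> for the support function of \<open>Y\<close>. Then \<open>e \<subseteq> CH Y\<close> means that in every direction
  \<open>v\<close> some \<open>y \<in> Y\<close> has \<open>h e v \<le> h y v\<close>. For discs, the directions with \<open>h e v \<le> h y v\<close> form an
  arc of the circle of directions. If \<open>e\<close> is not contained in \<open>a\<close>, pick \<open>u\<close> with \<open>h a u < h e u\<close>;
  the implications from \<open>ab\<close>, \<open>ac\<close>, \<open>ad\<close> put \<open>u\<close> in the arcs of \<open>b\<close>, \<open>c\<close> and \<open>d\<close>. These three
  arcs cover the circle and share a point, so two of them already cover it (Helly's theorem on
  the line for the complements, which are intervals once the circle is projected
  stereographically from \<open>u\<close>). This contradicts tightness.
\<close>

text \<open>Both sides compare support functions: \<open>x i \<bullet> v + r i * norm v\<close> is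
  that of the \<open>i\<close>-th ball, and the hull of the finite union has their maximum.
  Conversely the hull is compact, so a point outside it can be strictly separated from it.\<close>

lemma cball_subset_convex_hull_cballs_iff:
  fixes x :: "'i \<Rightarrow> 'a::euclidean_space"
  assumes I: "finite I" "I \<noteq> {}" and r: "\<And>i. i \<in> I \<Longrightarrow> 0 \<le> r i" and s: "0 \<le> s"
  shows "cball y s \<subseteq> convex hull (\<Union>i\<in>I. cball (x i) (r i)) \<longleftrightarrow>
    (\<forall>v. \<exists>i\<in>I. y \<bullet> v + s * norm v \<le> x i \<bullet> v + r i * norm v)" (is "_ \<subseteq> ?H \<longleftrightarrow> _")
proof (intro iffI allI)
  fix v
  assume sub: "cball y s \<subseteq> ?H"
  define k where "k = Max ((\<lambda>i. x i \<bullet> v + r i * norm v) ` I)"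
  have "z \<bullet> v \<le> k" if "i \<in> I" "z \<in> cball (x i) (r i)" for i z
  proof -
    have "(z - x i) \<bullet> v \<le> norm (z - x i) * norm v"
      by (rule norm_cauchy_schwarz)
    also have "\<dots> \<le> r i * norm v"
      using that by (intro mult_right_mono) (auto simp: dist_norm norm_minus_commute)
    finally have "z \<bullet> v \<le> x i \<bullet> v + r i * norm v"
      by (simp add: inner_diff_left)
    also have "\<dots> \<le> k"
      unfolding k_def using I that by (intro Max_ge) auto
    finally show ?thesis .
  qed
  then have "?H \<subseteq> {z. v \<bullet> z \<le> k}"
    by (intro hull_minimal convex_halfspace_le) (auto simp: inner_commute)
  \<comment> \<open>The farthest point of the ball in direction \<open>v\<close>; for
    \<open>v = 0\<close> division by zero yields \<open>y\<close>, which still fits.\<close>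
  moreover have "y + (s / norm v) *\<^sub>R v \<in> cball y s"
    using s by (auto simp: dist_norm)
  ultimately have "v \<bullet> (y + (s / norm v) *\<^sub>R v) \<le> k"
    using sub by blast
  moreover have "v \<bullet> (y + (s / norm v) *\<^sub>R v) = y \<bullet> v + s * norm v"
    by (simp add: inner_add_right inner_commute power2_norm_eq_inner [symmetric] power2_eq_square)
  moreover have "k \<in> (\<lambda>i. x i \<bullet> v + r i * norm v) ` I"
    unfolding k_def using I by (intro Max_in) auto
  ultimately show "\<exists>i\<in>I. y \<bullet> v + s * norm v \<le> x i \<bullet> v + r i * norm v"
    by auto
next
  assume *: "\<forall>v. \<exists>i\<in>I. y \<bullet> v + s * norm v \<le> x i \<bullet> v + r i * norm v"
  show "cball y s \<subseteq> ?H"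
  proof (rule ccontr)
    assume "\<not> cball y s \<subseteq> ?H"
    then obtain z where z: "z \<in> cball y s" "z \<notin> ?H"
      by blast
    have "compact (\<Union>i\<in>I. cball (x i) (r i))"
      using I by (intro compact_UN) auto
    then have "closed ?H"
      by (intro compact_imp_closed compact_convex_hull)
    then obtain w k where w: "w \<bullet> z < k" "\<And>p. p \<in> ?H \<Longrightarrow> k < w \<bullet> p"
      using separating_hyperplane_closed_point [OF convex_convex_hull _ z(2)] by auto
    \<comment> \<open>The hull lies on the upper side of the separating line, so the direction to
      test is \<open>- w\<close>; the point of ball \<open>i\<close> lowest along \<open>w\<close>
      then gives the contradiction.\<close>
    obtain i where i: "i \<in> I" "y \<bullet> (- w) + s * norm (- w) \<le> x i \<bullet> (- w) + r i * norm (- w)"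
      using * by blast
    have "x i - (r i / norm w) *\<^sub>R w \<in> cball (x i) (r i)"
      using r [OF i(1)] by (auto simp: dist_norm)
    then have "x i - (r i / norm w) *\<^sub>R w \<in> ?H"
      using i(1) by (intro hull_inc) blast
    then have "k < w \<bullet> (x i - (r i / norm w) *\<^sub>R w)"
      by (rule w(2))
    also have "\<dots> = x i \<bullet> w - r i * norm w"
      by (simp add: inner_diff_right inner_commute power2_norm_eq_inner [symmetric] power2_eq_square)
    also have "\<dots> \<le> y \<bullet> w - s * norm w"
      using i(2) by simp
    also have "\<dots> \<le> w \<bullet> z"
    proof -
      have "(y - z) \<bullet> w \<le> norm (y - z) * norm w"
        by (rule norm_cauchy_schwarz)
      also have "\<dots> \<le> s * norm w"
        using z(1) by (intro mult_right_mono) (auto simp: dist_norm)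
      finally show ?thesis
        by (simp add: inner_diff_left inner_diff_right inner_commute)
    qed
    finally show False
      using w(1) by simp
  qed
qed

text \<open>Inverse stereographic projection with pole \<open>u\<close>, where \<open>w\<close> is
  \<open>u\<close> turned by a right angle. The usual denominator \<open>t\<^sup>2 + 1\<close> is
  absorbed into \<open>c\<close>, so that up to this factor both \<open>v\<close> and its norm are
  quadratic in \<open>t\<close>.\<close>

lemma stereographic_param:
  fixes u v :: "real^2"
  defines "w \<equiv> vector [- u $ 2, u $ 1]"
  assumes "u \<noteq> 0"
  obtains (pole) c where "0 \<le> c" "v = c *\<^sub>R u"
  | (affine) c t where "0 < c" "v = c *\<^sub>R ((t\<^sup>2 - 1) *\<^sub>R u + (2 * t) *\<^sub>R w)"
      "norm v = c * ((t\<^sup>2 + 1) * norm u)"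
proof -
  define N where "N = (u $ 1)\<^sup>2 + (u $ 2)\<^sup>2"
  have norm_u: "norm u = sqrt N"
    by (simp add: norm_vec_def L2_set_def sum_2 N_def)
  have "N > 0"
    using assms(2) by (auto simp: N_def vec_eq_iff forall_2 sum_power2_gt_zero_iff)
  \<comment> \<open>Coordinates of \<open>v\<close> in the orthogonal basis \<open>u\<close>,
    \<open>w\<close>, whose vectors both have squared length \<open>N\<close>.\<close>
  define \<alpha> where "\<alpha> = (v $ 1 * u $ 1 + v $ 2 * u $ 2) / N"
  define \<beta> where "\<beta> = (v $ 2 * u $ 1 - v $ 1 * u $ 2) / N"
  have v: "v = \<alpha> *\<^sub>R u + \<beta> *\<^sub>R w"
  proof -
    have N\<alpha>\<beta>: "N * \<alpha> = v $ 1 * u $ 1 + v $ 2 * u $ 2" "N * \<beta> = v $ 2 * u $ 1 - v $ 1 * u $ 2"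
      using \<open>N > 0\<close> by (simp_all add: \<alpha>_def \<beta>_def)
    have "N * v $ 1 = N * (\<alpha> * u $ 1 - \<beta> * u $ 2)" "N * v $ 2 = N * (\<alpha> * u $ 2 + \<beta> * u $ 1)"
      unfolding right_diff_distrib distrib_left mult.assoc [symmetric] N\<alpha>\<beta>
      by (simp_all add: N_def power2_eq_square algebra_simps)
    then show ?thesis
      using \<open>N > 0\<close> by (simp add: vec_eq_iff forall_2 w_def)
  qed
  define \<rho> where "\<rho> = sqrt (\<alpha>\<^sup>2 + \<beta>\<^sup>2)"
  have \<rho>2: "\<rho>\<^sup>2 = \<alpha>\<^sup>2 + \<beta>\<^sup>2"
    by (simp add: \<rho>_def)
  have norm_v: "norm v = \<rho> * norm u"
  proof -
    have "(v $ 1)\<^sup>2 + (v $ 2)\<^sup>2 = (\<alpha>\<^sup>2 + \<beta>\<^sup>2) * N"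
      by (simp add: v w_def N_def power2_eq_square algebra_simps)
    then show ?thesis
      unfolding norm_u \<rho>_def real_sqrt_mult [symmetric]
      by (simp add: norm_vec_def L2_set_def sum_2)
  qed
  have "\<bar>\<alpha>\<bar> \<le> \<rho>"
    unfolding \<rho>_def by (rule real_le_rsqrt) simp
  show ?thesis
  proof (cases "\<rho> = \<alpha>")
    case True
    then have "\<beta> = 0" "0 \<le> \<alpha>"
      using \<rho>2 \<open>\<bar>\<alpha>\<bar> \<le> \<rho>\<close> by auto
    then show ?thesis
      using v by (intro pole [of \<alpha>]) auto
  next
    case False
    \<comment> \<open>The line from the pole through the normalised point has parameter
      \<open>t = \<beta> / m\<close>, and \<open>c = m / 2\<close>.\<close>
    define m where "m = \<rho> - \<alpha>"
    have m: "m > 0" "\<rho> = m + \<alpha>"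
      using False \<open>\<bar>\<alpha>\<bar> \<le> \<rho>\<close> by (auto simp: m_def)
    have \<beta>2: "\<beta>\<^sup>2 = m * (m + 2 * \<alpha>)"
      using \<rho>2 unfolding m(2) by (simp add: power2_eq_square algebra_simps)
    have coeffs: "(m / 2) * ((\<beta> / m)\<^sup>2 - 1) = \<alpha>" "(m / 2) * (2 * (\<beta> / m)) = \<beta>"
      "(m / 2) * ((\<beta> / m)\<^sup>2 + 1) = \<rho>"
      using m(1) unfolding power_divide \<beta>2 m(2) by (simp_all add: field_simps power2_eq_square)
    show ?thesis
    proof (rule affine)
      show "0 < m / 2"
        using m(1) by simp
      show "v = (m / 2) *\<^sub>R (((\<beta> / m)\<^sup>2 - 1) *\<^sub>R u + (2 * (\<beta> / m)) *\<^sub>R w)"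
        unfolding scaleR_add_right scaleR_scaleR coeffs by (rule v)
      show "norm v = (m / 2) * (((\<beta> / m)\<^sup>2 + 1) * norm u)"
        unfolding mult.assoc [symmetric] unfolding coeffs by (rule norm_v)
    qed
  qed
qed

lemma quadratic_neg_between:
  fixes A B C x y z :: real
  assumes "0 \<le> A" "x \<le> y" "y \<le> z" "A * x\<^sup>2 + B * x + C < 0" "A * z\<^sup>2 + B * z + C < 0"
  shows "A * y\<^sup>2 + B * y + C < 0"
proof (cases "x = z")
  case True
  then show ?thesis using assms by simp
next
  case False
  then have "x < z" using assms by simp
  \<comment> \<open>A convex quadratic lies below its chord: the first two terms are the linear
    interpolation, the last is the nonnegative gap.\<close>
  have "(z - x) * (A * y\<^sup>2 + B * y + C) =
      (z - y) * (A * x\<^sup>2 + B * x + C) + (y - x) * (A * z\<^sup>2 + B * z + C)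
      - A * ((z - x) * (z - y) * (y - x))"
    by (simp add: power2_eq_square algebra_simps)
  also have "\<dots> < 0"
  proof -
    have "0 \<le> A * ((z - x) * (z - y) * (y - x))"
      using assms by simp
    moreover have "(z - y) * (A * x\<^sup>2 + B * x + C) \<le> 0" "(y - x) * (A * z\<^sup>2 + B * z + C) \<le> 0"
      using assms by (simp_all add: mult_nonneg_nonpos)
    moreover have "(z - y) * (A * x\<^sup>2 + B * x + C) < 0 \<or> (y - x) * (A * z\<^sup>2 + B * z + C) < 0"
      using assms \<open>x < z\<close> by (cases "y < z") (auto simp: mult_pos_neg)
    ultimately show ?thesis by linarith
  qed
  finally show ?thesis
    using \<open>x < z\<close> by (simp add: mult_less_0_iff)
qed

lemma arcs_common_point_two_cover:
  fixes p q r u :: "real^2" and k l m :: real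
  assumes "u \<noteq> 0"
    and u: "0 \<le> p \<bullet> u + k * norm u" "0 \<le> q \<bullet> u + l * norm u" "0 \<le> r \<bullet> u + m * norm u"
    and cover: "\<And>v. 0 \<le> p \<bullet> v + k * norm v \<or> 0 \<le> q \<bullet> v + l * norm v \<or> 0 \<le> r \<bullet> v + m * norm v"
    and x: "q \<bullet> x + l * norm x < 0" "r \<bullet> x + m * norm x < 0"
    and y: "p \<bullet> y + k * norm y < 0" "r \<bullet> y + m * norm y < 0"
    and z: "p \<bullet> z + k * norm z < 0" "q \<bullet> z + l * norm z < 0"
  shows False
proof -
  define w :: "real^2" where "w = vector [- u $ 2, u $ 1]"
  define V where "V = (\<lambda>t. (t\<^sup>2 - 1) *\<^sub>R u + (2 * t) *\<^sub>R w)"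
  define g where "g = (\<lambda>p k t. p \<bullet> V t + k * ((t\<^sup>2 + 1) * norm u))"
  \<comment> \<open>One \<open>t\<close> serves all \<open>p\<close> and \<open>k\<close>, since it
    depends on \<open>v\<close> alone. The pole case is excluded because \<open>p'\<close>,
    \<open>k'\<close> give opposite signs at \<open>v\<close> and \<open>u\<close>.\<close>
  have param: "\<exists>t. \<forall>p k. p \<bullet> v + k * norm v < 0 \<longrightarrow> g p k t < 0"
    if v: "p' \<bullet> v + k' * norm v < 0" and u': "0 \<le> p' \<bullet> u + k' * norm u" for v p' k'
    using \<open>u \<noteq> 0\<close>
  proof (cases rule: stereographic_param [of u v])
    case (pole c)
    then have "p' \<bullet> v + k' * norm v = c * (p' \<bullet> u + k' * norm u)"
      by (simp add: algebra_simps)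
    then show ?thesis
      using v u' pole(1) by (simp add: mult_less_0_iff)
  next
    case (affine c t)
    have "p \<bullet> v + k * norm v = c * g p k t" for p k
      unfolding affine(3) unfolding affine(2)
      by (simp add: g_def V_def w_def distrib_left mult.left_commute)
    then show ?thesis
      using affine(1) by (auto simp: mult_less_0_iff)
  qed
  obtain x' where x': "g q l x' < 0" "g r m x' < 0"
    using param [OF x(1) u(2)] x by blast
  obtain y' where y': "g p k y' < 0" "g r m y' < 0"
    using param [OF y(1) u(1)] y by blast
  obtain z' where z': "g p k z' < 0" "g q l z' < 0"
    using param [OF z(1) u(1)] z by blast
  \<comment> \<open>The leading coefficient is the value at \<open>u\<close>, which is nonnegative
    for all three arcs; so each complement becomes an interval in \<open>t\<close>.\<close>
  have g_eq: "g p k t = (p \<bullet> u + k * norm u) * t\<^sup>2 + 2 * (p \<bullet> w) * t + (k * norm u - p \<bullet> u)"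
    for p k t
    by (simp add: g_def V_def inner_add_right algebra_simps)
  have between: "g p k t < 0"
    if "0 \<le> p \<bullet> u + k * norm u" "g p k t1 < 0" "g p k t2 < 0" "t1 \<le> t" "t \<le> t2" for p k t t1 t2
    using quadratic_neg_between [OF that(1,4,5)] that(2,3) unfolding g_eq by blast
  \<comment> \<open>Helly on the line: the median of \<open>x'\<close>, \<open>y'\<close>,
    \<open>z'\<close> lies in all three intervals.\<close>
  have "\<exists>t. g p k t < 0 \<and> g q l t < 0 \<and> g r m t < 0"
    using x' y' z' between [OF u(1)] between [OF u(2)] between [OF u(3)]
    by (meson linear)
  then obtain t where t: "g p k t < 0" "g q l t < 0" "g r m t < 0"
    by blast
  have "norm (V t) = (t\<^sup>2 + 1) * norm u"
  proof -
    have "(norm (V t))\<^sup>2 = ((t\<^sup>2 + 1) * norm u)\<^sup>2"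
      unfolding power_mult_distrib power2_norm_eq_inner
      by (simp add: V_def w_def inner_vec_def sum_2 power2_eq_square algebra_simps)
    then show ?thesis
      by (rule power2_eq_imp_eq) auto
  qed
  then show False
    using cover [of "V t"] t by (simp add: g_def)
qed

theorem theorem3p1:
  fixes a b c d e :: "(real^2) set"
  assumes "is_circle a" and "is_circle b" and "is_circle c" and "is_circle d" and "is_circle e"
    and "b \<noteq> c" and "b \<noteq> d" and "c \<noteq> d"
    and "tight_implication {b, c, d} e"
    and "implication {a, b} e"
    and "implication {a, c} e"
    and "implication {a, d} e"
  shows "implication {a} e"
proof (rule ccontr)
  assume not_a: "\<not> implication {a} e"
  define C where "C = (\<lambda>i::(real^2) \<times> real. cball (fst i) (snd i))"
  define h where "h = (\<lambda>(i::(real^2) \<times> real) v. fst i \<bullet> v + snd i * norm v)"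
  have circle: "\<exists>i. 0 \<le> snd i \<and> u = C i" if "is_circle u" for u
    using that by (auto simp: is_circle_def C_def)
  obtain a' b' c' d' e' where
    nonneg: "0 \<le> snd a'" "0 \<le> snd b'" "0 \<le> snd c'" "0 \<le> snd d'" "0 \<le> snd e'"
    and eq: "a = C a'" "b = C b'" "c = C c'" "d = C d'" "e = C e'"
    using assms(1-5) [THEN circle] by blast
  have CH: "e \<subseteq> CH (C ` I) \<longleftrightarrow> (\<forall>v. \<exists>i\<in>I. h e' v \<le> h i v)"
    if "finite I" "I \<noteq> {}" "\<And>i. i \<in> I \<Longrightarrow> 0 \<le> snd i" for I
    using cball_subset_convex_hull_cballs_iff
      [of I snd "snd e'" "fst e'" fst, OF that nonneg(5)]
    by (simp add: CH_def C_def h_def eq)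
  have CH2: "C e' \<subseteq> CH {C i, C j} \<longleftrightarrow> (\<forall>v. h e' v \<le> h i v \<or> h e' v \<le> h j v)"
    if "0 \<le> snd i" "0 \<le> snd j" for i j
    using CH [of "{i, j}"] that by (auto simp: eq)
  obtain u where u: "h a' u < h e' u"
    using not_a CH [of "{a'}"] nonneg by (auto simp: implication_def eq not_le)
  have u_arcs: "h e' u \<le> h b' u" "h e' u \<le> h c' u" "h e' u \<le> h d' u"
    using assms(10-12) u CH2 [OF nonneg(1,2)] CH2 [OF nonneg(1,3)] CH2 [OF nonneg(1,4)]
    unfolding implication_def eq by (meson not_le)+
  have "u \<noteq> 0"
    using u by (auto simp: h_def)
  have cover: "h e' v \<le> h b' v \<or> h e' v \<le> h c' v \<or> h e' v \<le> h d' v" for v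
    using assms(9) CH [of "{b', c', d'}"] nonneg
    by (auto simp: tight_implication_def implication_def eq)
  \<comment> \<open>Distinctness enters here: deleting one letter leaves exactly the other
    two.\<close>
  have diff: "{b, c, d} - {b} = {c, d}" "{b, c, d} - {c} = {b, d}" "{b, c, d} - {d} = {b, c}"
    using assms(6-8) by auto
  have "\<not> e \<subseteq> CH {c, d}" "\<not> e \<subseteq> CH {b, d}" "\<not> e \<subseteq> CH {b, c}"
    using assms(9) diff unfolding tight_implication_def by (metis insertI1 insertI2)+
  then obtain x y z where xyz:
    "h c' x < h e' x" "h d' x < h e' x"
    "h b' y < h e' y" "h d' y < h e' y"
    "h b' z < h e' z" "h c' z < h e' z"
    using nonneg by (auto simp: eq CH2 not_le)
  \<comment> \<open>A difference of two support functions has the same shape, with a radius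
    difference of either sign; hence \<open>k\<close>, \<open>l\<close>, \<open>m\<close> carry no
    sign condition in \<open>arcs_common_point_two_cover\<close>.\<close>
  have diff_eq: "h i v - h e' v = (fst i - fst e') \<bullet> v + (snd i - snd e') * norm v" for i v
    by (simp add: h_def algebra_simps)
  have le_iff: "h e' v \<le> h i v \<longleftrightarrow> 0 \<le> (fst i - fst e') \<bullet> v + (snd i - snd e') * norm v"
    and less_iff: "h i v < h e' v \<longleftrightarrow> (fst i - fst e') \<bullet> v + (snd i - snd e') * norm v < 0" for i v
    unfolding diff_eq [symmetric] by simp_all
  show False
    by (rule arcs_common_point_two_cover [OF \<open>u \<noteq> 0\<close> u_arcs [unfolded le_iff]
          cover [unfolded le_iff] xyz [unfolded less_iff]])
qed

end
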